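(* Let $p$ be a prime with $p\equiv3\pmod4$, let $r$ be odd, and let $0\le i<k<2r$ be such that $h(x)=x^{p^i+p^k}$ is planar on $\mathbb{F}_{p^{2r}}$. Let $f_1(x)=x^2+x^{2p^r}+h(x)-h(x)^{p^r}$. Then $f_1$ is not CCZ-equivalent to any generalized Budaghyan–Helleseth function on $\mathbb{F}_{p^{2r}}$.
   Context: A generalized Budaghyan–Helleseth function on $\mathbb{F}_{p^{2r}}$ is a function $B(x)=x^{p^r+1}+\omega\beta x^{p^s+1}+\omega\beta^{p^r}x^{(p^s+1)p^r}$, where $s$ is an integer, $\omega,\beta\in\mathbb{F}_{p^{2r}}$ with $\omega+\omega^{p^r}=0$, $\beta^{p^r-1}$ does not lie in the subgroup of $\mathbb{F}_{p^{2r}}^*$ of order $(p^r+1)/\gcd(p^r+1,p^s+1)$, and $x^{p^s}\ne -x$ for all $x\in\mathbb{F}_{p^{2r}}^*$. A function $f$ is planar if $x\mapsto f(x+a)-f(x)$ is a bijection for every $a\ne0$. Functions $F,G$ on $\mathbb{F}_q$ are CCZ-equivalent if an affine permutation of $\mathbb{F}_q\times\mathbb{F}_q$ (over the prime field) maps the graph of $F$ onto the graph of $G$. *)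

theory Defs
  imports
    "HOL-Library.Cardinality"
    "HOL-Library.Product_Plus"
    "HOL-Number_Theory.Cong"
    "HOL-Algebra.Group"
begin

definition planar :: "('a::field \<Rightarrow> 'a) \<Rightarrow> bool" where
  "planar f \<longleftrightarrow> (\<forall>a. a \<noteq> 0 \<longrightarrow> bij (\<lambda>x. f (x + a) - f x))"

text \<open>In a field of positive characteristic (in particular, a finite one), the multiples of 1
  are already the whole prime field.\<close>

definition prime_subfield :: "'a::{finite,field} set" where
  "prime_subfield = range of_nat"

definition prime_field_linear ::
    "('a::{finite,field} \<times> 'a \<Rightarrow> 'a \<times> 'a) \<Rightarrow> bool" where
  "prime_field_linear L \<longleftrightarrow>
     (\<forall>u v. L (u + v) = L u + L v) \<and>
     (\<forall>c\<in>prime_subfield. \<forall>x y. L (c * x, c * y) = (c * fst (L (x, y)), c * snd (L (x, y))))"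

definition affine_permutation ::
    "('a::{finite,field} \<times> 'a \<Rightarrow> 'a \<times> 'a) \<Rightarrow> bool" where
  "affine_permutation A \<longleftrightarrow>
     bij A \<and> (\<exists>L t. prime_field_linear L \<and> (\<forall>z. A z = L z + t))"

definition fun_graph :: "('a \<Rightarrow> 'b) \<Rightarrow> ('a \<times> 'b) set" where
  "fun_graph F = {(x, F x) | x. True}"

definition CCZ_equivalent ::
    "('a::{finite,field} \<Rightarrow> 'a) \<Rightarrow> ('a \<Rightarrow> 'a) \<Rightarrow> bool" where
  "CCZ_equivalent F G \<longleftrightarrow> (\<exists>A. affine_permutation A \<and> A ` fun_graph F = fun_graph G)"

definition field_mult_group :: "'a::field monoid" where
  "field_mult_group = \<lparr>carrier = UNIV - {0}, mult = (*), one = 1\<rparr>"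

text \<open>Meant for a field with \<open>p ^ (2 * r)\<close> elements. Its multiplicative group is cyclic, so there
  is exactly one subgroup \<open>H\<close> of the order in question. Taking \<open>s\<close> to be a natural number loses
  nothing: both the Frobenius power \<open>x ^ p ^ s\<close> and the residue of \<open>p ^ s\<close> modulo \<open>p ^ r + 1\<close>
  depend only on \<open>s\<close> modulo \<open>2 * r\<close>.\<close>

definition generalized_BH :: "nat \<Rightarrow> nat \<Rightarrow> ('a::{finite,field} \<Rightarrow> 'a) \<Rightarrow> bool" where
  "generalized_BH p r B \<longleftrightarrow>
     (\<exists>(s::nat) (\<omega>::'a) (\<beta>::'a).
        \<omega> + \<omega> ^ (p ^ r) = 0 \<and>
        \<not> (\<exists>H. subgroup H field_mult_group \<and>
               card H = (p ^ r + 1) div gcd (p ^ r + 1) (p ^ s + 1) \<and>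
               \<beta> ^ (p ^ r - 1) \<in> H) \<and>
        (\<forall>x::'a. x \<noteq> 0 \<longrightarrow> x ^ (p ^ s) \<noteq> - x) \<and>
        B = (\<lambda>x. x ^ (p ^ r + 1) + \<omega> * \<beta> * x ^ (p ^ s + 1)
                 + \<omega> * \<beta> ^ (p ^ r) * x ^ ((p ^ s + 1) * p ^ r)))"

end

theory Submission
  imports Defs "HOL-Computational_Algebra.Polynomial"
begin

text \<open>Write \<open>q = p ^ r\<close>, so \<open>q \<equiv> 3 (mod 4)\<close>, and let \<open>Tr\<close> and \<open>N\<close> be the trace and norm of
  \<open>F\<^bsub>q\<^sup>2\<^esub>\<close> over \<open>F\<^sub>q\<close>. Planarity of \<open>h\<close> makes \<open>f1\<close> planar, and then a CCZ-equivalence with \<open>B\<close> has the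
  form \<open>B (L x + t) = M (f1 x) + N' x + t'\<close> with \<open>L\<close>, \<open>M\<close>, \<open>N'\<close> additive and \<open>L\<close> injective. Since
  \<open>Tr (B z) = 2 N(z)\<close> for every generalized Budaghyan--Helleseth function, polarization shows that the
  bilinear form of \<open>2 N(L x)\<close> equals \<open>T\<close> applied to the bilinear form of \<open>f1\<close>, where \<open>T = Tr \<circ> M\<close>.
  Write \<open>L\<close> and \<open>T\<close> as linearized polynomials, let \<open>l j\<close> be the coefficients of \<open>L\<close>
  (indices modulo \<open>2 * r\<close>), and put
  \<open>m = (l (j + r)) ^ q\<close>. The coefficient at \<open>x ^ p ^ j * y ^ p ^ j\<close> gives \<open>l j * m \<in> F\<^sub>q\<close>, and the one at
  \<open>x ^ p ^ j * y ^ p ^ (j + r)\<close> gives \<open>N(l j) = - N(m)\<close>. If \<open>l j \<noteq> 0\<close>, then \<open>(l j * m)\<^sup>2 = - N(l j)\<^sup>2\<close>,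
  so \<open>- 1\<close> would be a square in \<open>F\<^sub>q\<close>; hence \<open>L = 0\<close>, a contradiction.\<close>

section \<open>Frobenius powers in a finite field with \<open>p ^ n\<close> elements\<close>

locale frobenius_field =
  fixes p n :: nat and ty :: "'a::{finite,field} itself"
  assumes prime_p: "prime p" and card_UNIV: "CARD('a) = p ^ n"
begin

lemma CHAR_eq: "CHAR('a) = p"
proof -
  have "prime CHAR('a)"
    using finite_imp_CHAR_pos[where 'a='a] prime_CHAR_semidom[where 'a='a] by simp
  moreover have "CHAR('a) dvd p ^ n"
  proof -
    \<comment> \<open>Translation by 1 permutes the field, so the sum of all elements absorbs
      \<open>p ^ n\<close> copies of 1.\<close>
    have "(\<Sum>x\<in>UNIV. x + 1) = (\<Sum>x\<in>UNIV. x :: 'a)"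
      by (rule sum.reindex_bij_witness[of _ "\<lambda>x. x - 1" "\<lambda>x. x + 1"]) auto
    then have "of_nat (p ^ n) = (0 :: 'a)"
      by (simp add: sum.distrib card_UNIV)
    then show ?thesis by (simp only: of_nat_eq_0_iff_char_dvd)
  qed
  ultimately show ?thesis
    using prime_p by (metis prime_dvd_power primes_dvd_imp_eq)
qed

lemma n_pos: "n > 0"
proof (rule ccontr)
  assume "\<not> n > 0"
  then have "CARD('a) = 1" using card_UNIV by simp
  then show False by (metis card_1_singletonE UNIV_I singletonD zero_neq_one)
qed

lemma frob_add: "(x + y :: 'a) ^ (p ^ j) = x ^ (p ^ j) + y ^ (p ^ j)"
  using freshmans_dream'[where 'a='a and m="p ^ j" and n=j] CHAR_eq prime_p by simp

lemma frob_sum: "(\<Sum>i\<in>A. f i :: 'a) ^ (p ^ j) = (\<Sum>i\<in>A. f i ^ (p ^ j))"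
  using freshmans_dream_sum'[where 'a='a and m="p ^ j" and n=j] CHAR_eq prime_p by simp

lemma frob_minus: "(- x :: 'a) ^ (p ^ j) = - (x ^ (p ^ j))"
proof -
  have "0 = (x + - x) ^ (p ^ j)" using prime_p by (simp add: prime_gt_0_nat)
  then show ?thesis by (simp only: frob_add) (simp add: eq_neg_iff_add_eq_0 add.commute)
qed

lemma frob_diff: "(x - y :: 'a) ^ (p ^ j) = x ^ (p ^ j) - y ^ (p ^ j)"
  using frob_add[of x "- y"] by (simp add: frob_minus)

lemma frob_card: "(x :: 'a) ^ (p ^ n) = x"
proof (cases "x = 0")
  case False
  \<comment> \<open>Multiplication by \<open>x\<close> permutes the nonzero elements; comparing
    products makes the power of \<open>x\<close> equal to 1.\<close>
  have "(\<Prod>y\<in>-{0}. y) = (\<Prod>y\<in>-{0}. x * y)"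
    by (rule prod.reindex_bij_witness[of _ "\<lambda>y. x * y" "\<lambda>y. y / x"]) (use False in auto)
  also have "\<dots> = x ^ card (-{0::'a}) * (\<Prod>y\<in>-{0}. y)"
    by (simp add: prod.distrib)
  finally have "x ^ card (-{0::'a}) = 1" by simp
  moreover have "Suc (card (-{0::'a})) = p ^ n"
    by (metis Compl_eq_Diff_UNIV UNIV_I card.remove card_UNIV finite)
  ultimately show ?thesis by (metis mult.right_neutral power_Suc)
qed (use prime_p in \<open>simp add: prime_gt_0_nat\<close>)

lemma frob_mod: "(x :: 'a) ^ (p ^ (j mod n)) = x ^ (p ^ j)"
proof -
  have "x ^ (p ^ (n * m)) = x" for m
    by (induction m) (simp_all add: power_add power_mult frob_card)
  then have "x ^ (p ^ (n * (j div n) + j mod n)) = x ^ (p ^ (j mod n))"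
    by (simp only: power_add power_mult)
  then show ?thesis by (simp only: mult_div_mod_eq)
qed

text \<open>The polynomial X^p - X has at most \<open>p\<close> roots, and the \<open>p\<close>
  distinct multiples of 1 already supply that many.\<close>

lemma frob_fixed_imp_of_nat:
  assumes "(x :: 'a) ^ p = x"
  obtains c where "x = of_nat c"
proof -
  define P :: "'a poly" where "P = monom 1 p - monom 1 1"
  have p1: "p > 1" using prime_p by (rule prime_gt_1_nat)
  have "poly.coeff P p \<noteq> 0" using p1 by (simp add: P_def)
  then have "P \<noteq> 0" by auto
  have "degree P \<le> p" unfolding P_def
    using p1 by (intro degree_diff_le) (auto simp: degree_monom_eq)
  have sub: "of_nat ` {..<p} \<subseteq> {x. poly P x = 0}"
  proof safe
    fix m :: nat assume "m < p"
    have "(of_nat m :: 'a) ^ p = of_nat m"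
    proof (induction m)
      case (Suc m)
      then show ?case using frob_add[of 1 "of_nat m" 1] by simp
    qed (use p1 in auto)
    then show "poly P (of_nat m) = 0" by (simp add: P_def poly_monom)
  qed
  have inj: "inj_on (of_nat :: nat \<Rightarrow> 'a) {..<p}"
  proof (rule linorder_inj_onI)
    fix a b :: nat assume "a < b" "a \<in> {..<p}" "b \<in> {..<p}"
    then have "\<not> p dvd b - a" by (auto dest: dvd_imp_le)
    then show "(of_nat a :: 'a) \<noteq> of_nat b"
      using of_nat_eq_iff_char_dvd[OF \<open>a < b\<close>, where 'a='a] CHAR_eq by simp
  qed auto
  have "of_nat ` {..<p} = {x. poly P x = 0}"
  proof (rule card_seteq[OF _ sub])
    show "card {x. poly P x = 0} \<le> card ((of_nat :: nat \<Rightarrow> 'a) ` {..<p})"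
      using card_poly_roots_bound[OF \<open>P \<noteq> 0\<close>] \<open>degree P \<le> p\<close> inj by (simp add: card_image)
  qed simp
  moreover have "poly P x = 0" using assms by (simp add: P_def poly_monom)
  ultimately show ?thesis using that by blast
qed

section \<open>Linearized polynomials: representation of additive maps and uniqueness of
  coefficients\<close>

definition linearized :: "('a \<Rightarrow> 'a) \<Rightarrow> bool" where
  "linearized f \<longleftrightarrow> (\<exists>c. \<forall>x. f x = (\<Sum>j<n. c j * x ^ (p ^ j)))"

lemma linearizedE:
  assumes "linearized f"
  obtains c where "\<And>x. f x = (\<Sum>j<n. c j * x ^ (p ^ j))"
  using assms by (auto simp: linearized_def)

lemma linearized_id: "linearized (\<lambda>x. x)"
  unfolding linearized_def
  by (rule exI[of _ "\<lambda>j. if j = 0 then 1 else 0"])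
    (simp add: n_pos sum.delta if_distrib[of "\<lambda>c. c * _"] cong: if_cong)

lemma linearized_zero: "linearized (\<lambda>x. 0)"
  unfolding linearized_def by (rule exI[of _ "\<lambda>j. 0"]) simp

lemma linearized_add:
  assumes "linearized f" "linearized g"
  shows "linearized (\<lambda>x. f x + g x)"
proof -
  from assms obtain c d where "\<And>x. f x = (\<Sum>j<n. c j * x ^ (p ^ j))"
    "\<And>x. g x = (\<Sum>j<n. d j * x ^ (p ^ j))" by (metis linearizedE)
  then show ?thesis unfolding linearized_def
    by (intro exI[of _ "\<lambda>j. c j + d j"]) (simp add: distrib_right sum.distrib)
qed

lemma linearized_scale:
  assumes "linearized f"
  shows "linearized (\<lambda>x. a * f x)"
proof -
  from assms obtain c where "\<And>x. f x = (\<Sum>j<n. c j * x ^ (p ^ j))" by (metis linearizedE)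
  then show ?thesis unfolding linearized_def
    by (intro exI[of _ "\<lambda>j. a * c j"]) (simp add: sum_distrib_left mult.assoc)
qed

lemma bij_betw_shift: "bij_betw (\<lambda>j. (j + s) mod n) {..<n} {..<n}"
proof -
  have "inj_on (\<lambda>j. (j + s) mod n) {..<n}"
  proof (rule linorder_inj_onI)
    fix a b :: nat assume ab: "a < b" "a \<in> {..<n}" "b \<in> {..<n}"
    show "(a + s) mod n \<noteq> (b + s) mod n"
    proof
      assume "(a + s) mod n = (b + s) mod n"
      then have "[a = b] (mod n)"
        by (metis cong_def cong_add_rcancel_nat)
      with ab show False by (simp add: cong_def)
    qed
  qed auto
  moreover have "(\<lambda>j. (j + s) mod n) ` {..<n} \<subseteq> {..<n}" using n_pos by auto
  ultimately show ?thesis by (simp add: bij_betw_def endo_inj_surj)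
qed

lemma linearized_sum_frob:
  "linearized (\<lambda>x. \<Sum>j<n. c j * x ^ (p ^ (j + s)))"
proof -
  let ?\<pi> = "\<lambda>j. (j + s) mod n"
  define d where "d = c \<circ> inv_into {..<n} ?\<pi>"
  have "(\<Sum>j<n. c j * x ^ (p ^ (j + s))) = (\<Sum>j<n. d j * x ^ (p ^ j))" for x
  proof -
    have "(\<Sum>j<n. c j * x ^ (p ^ (j + s))) = (\<Sum>j<n. d (?\<pi> j) * x ^ (p ^ ?\<pi> j))"
      using inv_into_f_f[OF bij_betw_imp_inj_on[OF bij_betw_shift[of s]]]
      by (intro sum.cong) (simp_all add: d_def frob_mod)
    also have "\<dots> = (\<Sum>j<n. d j * x ^ (p ^ j))"
      by (rule sum.reindex_bij_betw[OF bij_betw_shift])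
    finally show ?thesis .
  qed
  then show ?thesis unfolding linearized_def by blast
qed

lemma linearized_frob:
  assumes "linearized f"
  shows "linearized (\<lambda>x. f x ^ p)"
proof -
  from assms obtain c where c: "\<And>x. f x = (\<Sum>j<n. c j * x ^ (p ^ j))" by (metis linearizedE)
  have "f x ^ p = (\<Sum>j<n. c j ^ p * x ^ (p ^ (j + 1)))" for x
    using frob_sum[of "\<lambda>j. c j * x ^ (p ^ j)" "{..<n}" 1]
    by (simp add: c power_mult_distrib mult.commute flip: power_mult)
  then show ?thesis using linearized_sum_frob[of "\<lambda>j. c j ^ p" 1] by simp
qed

lemma linearized_imp_additive:
  assumes "linearized f"
  shows "additive f"
proof -
  from assms obtain c where c: "\<And>x. f x = (\<Sum>j<n. c j * x ^ (p ^ j))" by (metis linearizedE)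
  show ?thesis by standard (simp add: c frob_add distrib_left sum.distrib)
qed

lemma additive_of_nat:
  assumes "additive f"
  shows "f (of_nat m * x :: 'a) = of_nat m * (f x :: 'a)"
  by (induction m) (simp_all add: distrib_right additive.add[OF assms] additive.zero[OF assms])

text \<open>Newton interpolation: correcting \<open>R\<close> by a multiple of \<open>A\<close> makes it agree with \<open>L\<close> at one
  more point \<open>e\<close>, and the new \<open>A\<close> vanishes exactly on \<open>ker A + F\<^sub>p e\<close>.\<close>

lemma additive_eq_on_kernel_imp_linearized:
  assumes L: "additive L"
    and "linearized A" and "linearized R" and "\<And>x. A x = 0 \<Longrightarrow> L x = R x"
  shows "linearized (L :: 'a \<Rightarrow> 'a)"
  using assms(2-)
proof (induction "card {x. A x \<noteq> 0}" arbitrary: A R rule: less_induct)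
  case less
  note A = linearized_imp_additive[OF less.prems(1)]
  show ?case
  proof (cases "\<exists>e. A e \<noteq> 0")
    case False
    then have "L = R" using less.prems(3) by auto
    then show ?thesis using less.prems(2) by simp
  next
    case True
    then obtain e where e: "A e \<noteq> 0" ..
    define R' where "R' x = R x + (L e - R e) / A e * A x" for x
    define A' where "A' x = A x ^ p + - (A e ^ (p - 1)) * A x" for x
    have p0: "p > 0" using prime_p by (rule prime_gt_0_nat)
    have linR': "linearized R'" unfolding R'_def
      by (intro linearized_add linearized_scale less.prems)
    have linA': "linearized A'" unfolding A'_def
      by (intro linearized_add linearized_scale linearized_frob less.prems)
    have R'e: "R' e = L e" using e by (simp add: R'_def)
    have A'e: "A' e = 0"
      using p0 by (simp add: A'_def flip: power_Suc2)
    show ?thesis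
    proof (rule less.hyps[OF _ linA' linR'])
      \<comment> \<open>Each \<open>A' x\<close> is a multiple of \<open>A x\<close>, and
        \<open>e\<close> has become a zero, so the support shrinks strictly.\<close>
      have "{x. A' x \<noteq> 0} \<subset> {x. A x \<noteq> 0}"
        using e A'e p0 by (auto simp: A'_def)
      then show "card {x. A' x \<noteq> 0} < card {x. A x \<noteq> 0}" by (simp add: psubset_card_mono)
    next
      fix x assume "A' x = 0"
      then have "A x ^ p = A e ^ (p - 1) * A x" by (simp add: A'_def)
      then have "A x ^ p * A e = A e ^ p * A x"
        using p0 by (metis mult.assoc mult.commute power_minus_mult)
      then have "(A x / A e) ^ p = A x / A e"
        using e by (simp add: power_divide field_simps)
      \<comment> \<open>The quotient is fixed by the Frobenius map, hence lies in the prime field;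
        so \<open>x\<close> differs from a multiple of \<open>e\<close> by an element of the kernel
        of \<open>A\<close>.\<close>
      then obtain m where "A x / A e = of_nat m" by (rule frob_fixed_imp_of_nat)
      then have "A x = of_nat m * A e" using e by (simp add: field_simps)
      then have z: "A (x - of_nat m * e) = 0"
        by (simp add: additive.diff[OF A] additive_of_nat[OF A])
      have R': "additive R'" by (rule linearized_imp_additive[OF linR'])
      have "L (x - of_nat m * e) = R' (x - of_nat m * e)"
        using less.prems(3)[OF z] z by (simp add: R'_def)
      then show "L x = R' x"
        by (simp add: additive.diff[OF L] additive.diff[OF R'] additive_of_nat[OF L]
            additive_of_nat[OF R'] R'e)
    qed
  qed
qed

text \<open>The interpolation starts from \<open>A = id\<close>, whose kernel is zero, and
  \<open>R = 0\<close>.\<close>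

lemma additive_imp_linearized:
  assumes "additive L"
  shows "linearized L"
  using additive_eq_on_kernel_imp_linearized[OF assms linearized_id linearized_zero]
    additive.zero[OF assms]
  by simp

text \<open>Exponents stop below \<open>p ^ n\<close>, so the polynomial has smaller degree than the
  number of points at which it vanishes.\<close>

lemma linearized_coeffs_zero:
  assumes "\<And>x::'a. (\<Sum>j<n. c j * x ^ (p ^ j)) = 0" and "i < n"
  shows "c i = 0"
proof -
  define P where "P = (\<Sum>j<n. monom (c j) (p ^ j))"
  have p1: "p > 1" using prime_p by (rule prime_gt_1_nat)
  have deg: "degree P < p ^ n" unfolding P_def
  proof (rule degree_lessI; (intro allI impI)?)
    fix m assume "m \<ge> p ^ n"
    then have "p ^ j \<noteq> m" if "j < n" for j
      using that p1 by (metis not_le power_strict_increasing)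
    then show "poly.coeff (\<Sum>j<n. monom (c j) (p ^ j)) m = 0"
      by (simp add: coeff_sum)
  qed (use p1 in simp)
  have "P = 0"
    by (rule poly_eqI_degree[of UNIV])
      (use deg p1 assms(1) in \<open>auto simp: card_UNIV P_def poly_sum poly_monom\<close>)
  then have "0 = poly.coeff P (p ^ i)" by simp
  also have "\<dots> = (\<Sum>j<n. if j = i then c j else 0)"
    unfolding P_def coeff_sum using p1 by (intro sum.cong) auto
  finally show ?thesis using assms(2) by simp
qed

text \<open>For fixed \<open>y\<close> this is linearized in \<open>x\<close>, and each resulting
  coefficient is linearized in \<open>y\<close>.\<close>

lemma bilinearized_coeffs_zero:
  assumes "\<And>x y::'a. (\<Sum>a<n. \<Sum>b<n. c a b * (x ^ (p ^ a) * y ^ (p ^ b))) = 0"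
    and "i < n" and "j < n"
  shows "c i j = 0"
proof -
  have "(\<Sum>a<n. (\<Sum>b<n. c a b * y ^ (p ^ b)) * x ^ (p ^ a)) = 0" for x y :: 'a
    using assms(1)[of x y] by (simp add: sum_distrib_right sum_distrib_left mult_ac)
  then have "(\<Sum>b<n. c i b * y ^ (p ^ b)) = 0" for y
    using linearized_coeffs_zero[OF _ assms(2), of "\<lambda>a. \<Sum>b<n. c a b * y ^ (p ^ b)"] by blast
  then show ?thesis using linearized_coeffs_zero[OF _ assms(3), of "c i"] by blast
qed

text \<open>Brings a sum along the index pairs \<open>(s j, t j)\<close> into the shape to which
  \<open>bilinearized_coeffs_zero\<close> applies.\<close>

lemma sum_eq_double_sum:
  fixes e :: "nat \<Rightarrow> 'a"
  assumes "\<And>j. j < n \<Longrightarrow> s j < n" and "\<And>j. j < n \<Longrightarrow> t j < n"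
  shows "(\<Sum>j<n. e j * (X (s j) * Y (t j))) =
    (\<Sum>a<n. \<Sum>b<n. (\<Sum>j<n. if s j = a \<and> t j = b then e j else 0) * (X a * Y b))"
proof -
  have "(\<Sum>a<n. \<Sum>b<n. (\<Sum>j<n. if s j = a \<and> t j = b then e j else 0) * (X a * Y b)) =
    (\<Sum>a<n. \<Sum>b<n. \<Sum>j<n. if s j = a \<and> t j = b then e j * (X a * Y b) else 0)"
    by (auto simp: sum_distrib_right intro!: sum.cong)
  also have "\<dots> = (\<Sum>j<n. \<Sum>a<n. \<Sum>b<n. if s j = a \<and> t j = b then e j * (X a * Y b) else 0)"
    by (subst (2) sum.swap, subst sum.swap) (rule refl)
  also have "\<dots> = (\<Sum>j<n. e j * (X (s j) * Y (t j)))"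
  proof (rule sum.cong[OF refl])
    fix j assume j: "j \<in> {..<n}"
    have "(\<Sum>a<n. \<Sum>b<n. if s j = a \<and> t j = b then e j * (X a * Y b) else 0) =
      (\<Sum>a<n. if s j = a then \<Sum>b<n. if t j = b then e j * (X a * Y b) else 0 else 0)"
      by (intro sum.cong) auto
    also have "\<dots> = e j * (X (s j) * Y (t j))"
      using assms j by (simp add: sum.delta')
    finally show "(\<Sum>a<n. \<Sum>b<n. if s j = a \<and> t j = b then e j * (X a * Y b) else 0) =
      e j * (X (s j) * Y (t j))" .
  qed
  finally show ?thesis by simp
qed

end

section \<open>Conjugation in the quadratic extension and its effect on coefficients\<close>

locale quadratic_frobenius_field = frobenius_field p "2 * r" ty
  for p r :: nat and ty :: "'a::{finite,field} itself" +
  assumes odd_p: "odd p"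
begin

abbreviation conj :: "'a \<Rightarrow> 'a" where
  "conj x \<equiv> x ^ (p ^ r)"

text \<open>Conjugation is the Frobenius power \<open>p ^ r\<close>, so it moves exponent index
  \<open>j\<close> to \<open>opposite j\<close>. On indices below \<open>2 * r\<close> this is an
  involution without fixed points.\<close>

definition opposite :: "nat \<Rightarrow> nat" where
  "opposite j = (j + r) mod (2 * r)"

lemma r_pos: "r > 0"
  using n_pos by simp

lemma opposite_less: "opposite j < 2 * r"
  using r_pos by (simp add: opposite_def)

lemma opposite_opposite: "j < 2 * r \<Longrightarrow> opposite (opposite j) = j"
  by (auto simp: opposite_def mod_if)

lemma opposite_neq: "j < 2 * r \<Longrightarrow> opposite j \<noteq> j"
  by (auto simp: opposite_def mod_if)

lemma two_neq_0: "(2 :: 'a) \<noteq> 0"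
proof
  assume "(2 :: 'a) = 0"
  then have "p dvd 2"
    using of_nat_eq_0_iff_char_dvd[where 'a='a, of 2] CHAR_eq by simp
  then show False using odd_p prime_p by (metis primes_dvd_imp_eq two_is_prime_nat)
qed

lemma conj_conj: "conj (conj x) = x"
  using frob_card[of x] by (simp add: mult_2 power_add flip: power_mult)

lemma conj_two: "conj 2 = 2"
  using frob_add[of 1 1 r] by simp

lemma sum_opposite:
  "(\<Sum>j<2 * r. c j * (x :: 'a) ^ (p ^ (j + r))) = (\<Sum>j<2 * r. c (opposite j) * x ^ (p ^ j))"
proof -
  have "(\<Sum>j<2 * r. c (opposite j) * x ^ (p ^ j)) =
    (\<Sum>j<2 * r. c (opposite (opposite j)) * x ^ (p ^ opposite j))"
    using sum.reindex_bij_betw[OF bij_betw_shift[of r], of "\<lambda>j. c (opposite j) * x ^ (p ^ j)"]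
    by (simp add: opposite_def)
  also have "\<dots> = (\<Sum>j<2 * r. c j * x ^ (p ^ (j + r)))"
    using frob_mod by (intro sum.cong) (simp_all add: opposite_opposite, simp add: opposite_def)
  finally show ?thesis by simp
qed

lemma conj_linearized:
  "conj (\<Sum>j<2 * r. c j * x ^ (p ^ j)) = (\<Sum>j<2 * r. conj (c (opposite j)) * x ^ (p ^ j))"
  using sum_opposite[of "\<lambda>j. conj (c j)" x]
  by (simp add: frob_sum power_mult_distrib power_add power_mult)

lemma linearized_conj:
  "(\<Sum>j<2 * r. c j * conj x ^ (p ^ j)) = (\<Sum>j<2 * r. c (opposite j) * x ^ (p ^ j))"
  using sum_opposite[of c x] by (simp add: power_add mult.commute flip: power_mult)

section \<open>The coefficient comparison that forces \<open>L = 0\<close>\<close>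

lemma not_conj_square_neg_one:
  assumes "[p ^ r = 3] (mod 4)" and "conj w = w"
  shows "w\<^sup>2 \<noteq> - 1"
proof
  assume w: "w\<^sup>2 = - 1"
  \<comment> \<open>Since \<open>w\<close> has order dividing 4 and the exponent
    \<open>p ^ r\<close> is 3 modulo 4, \<open>conj w\<close> is \<open>w ^ 3\<close>, that is
    \<open>- w\<close>.\<close>
  have w4: "w ^ 4 = 1" using w by (simp add: power4_eq_xxxx power2_eq_square algebra_simps)
  have "p ^ r = 4 * (p ^ r div 4) + 3"
    using assms(1) by (simp add: cong_def) presburger
  then have "conj w = w ^ (4 * (p ^ r div 4)) * w ^ 3" by (metis power_add)
  also have "\<dots> = w * w\<^sup>2" by (simp add: power_mult w4 power3_eq_cube power2_eq_square)
  also have "\<dots> = - w" by (simp add: w)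
  finally have "2 * w = 0" using assms(2) by simp
  then have "w = 0" using two_neq_0 by simp
  with w show False by simp
qed

text \<open>The conditions on \<open>i\<close> and \<open>k\<close> keep the exponent pairs of
  \<open>H\<close> away from the positions \<open>(a, a)\<close> and \<open>(a, opposite a)\<close>,
  so the part of \<open>f1\<close> coming from \<open>h\<close> is invisible there.\<close>

lemma norm_trace_component_imp_zero:
  fixes L T :: "'a \<Rightarrow> 'a"
  assumes q: "[p ^ r = 3] (mod 4)" and "i < k" and "k < 2 * r" and "k \<noteq> i + r"
    and L: "additive L" and T: "additive T" and conjT: "\<And>z. conj (T z) = T z"
    and H_def: "\<And>x y. H x y = x ^ (p ^ i) * y ^ (p ^ k) + x ^ (p ^ k) * y ^ (p ^ i)"
    and eq: "\<And>x y. 2 * (L x * conj (L y) + conj (L x) * L y) =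
      T (2 * (x * y + conj (x * y)) + (H x y - conj (H x y)))"
  shows "L x = 0"
proof -
  from linearizedE[OF additive_imp_linearized[OF L]]
  obtain l where l: "\<And>x. L x = (\<Sum>j<2 * r. l j * x ^ (p ^ j))" by blast
  from linearizedE[OF additive_imp_linearized[OF T]]
  obtain c where c: "\<And>x. T x = (\<Sum>j<2 * r. c j * x ^ (p ^ j))" by blast
  define l' where "l' j = conj (l (opposite j))" for j
  define d where "d j = c j + c (opposite j)" for j
  define e where "e j = c j - c (opposite j)" for j
  define s where "s j = (i + j) mod (2 * r)" for j
  define t where "t j = (k + j) mod (2 * r)" for j
  define w where "w s t e a b = (\<Sum>j<2 * r. if s j = a \<and> t j = b then e j else 0)"
    for s t :: "nat \<Rightarrow> nat" and e :: "nat \<Rightarrow> 'a" and a b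
  have st: "s j < 2 * r" "t j < 2 * r" for j using r_pos by (simp_all add: s_def t_def)

  have L': "conj (L x) = (\<Sum>j<2 * r. l' j * x ^ (p ^ j))" for x
    by (simp add: l l'_def conj_linearized)
  \<comment> \<open>Values of \<open>T\<close> are fixed by conjugation, so uniqueness of
    coefficients pairs \<open>c j\<close> with \<open>c (opposite j)\<close>; their sum
    \<open>d j\<close> is then fixed too.\<close>
  have "conj (c (opposite j)) = c j" if "j < 2 * r" for j
  proof -
    have "(\<Sum>j<2 * r. (conj (c (opposite j)) - c j) * x ^ (p ^ j)) = 0" for x
      using conjT[of x] by (simp add: c conj_linearized left_diff_distrib sum_subtractf)
    from linearized_coeffs_zero[OF this that] show ?thesis by simp
  qed
  then have conj_d: "conj (d j) = d j" if "j < 2 * r" for j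
    using that opposite_less opposite_opposite unfolding d_def frob_add
    by (metis add.commute)

  have Td: "T (z + conj z) = (\<Sum>j<2 * r. d j * z ^ (p ^ j))" for z
    by (simp add: additive.add[OF T]) (simp add: c linearized_conj d_def distrib_right sum.distrib)
  have Te: "T (z - conj z) = (\<Sum>j<2 * r. e j * z ^ (p ^ j))" for z
    by (simp add: additive.diff[OF T])
      (simp add: c linearized_conj e_def left_diff_distrib sum_subtractf)
  have H: "H x y ^ (p ^ j) = x ^ (p ^ s j) * y ^ (p ^ t j) + x ^ (p ^ t j) * y ^ (p ^ s j)" for x y j
    unfolding H_def s_def t_def frob_mod frob_add power_mult_distrib
    by (simp add: power_add power_mult)

  \<comment> \<open>This compares both sides of \<open>eq\<close> at
    \<open>x ^ (p ^ a) * y ^ (p ^ b)\<close>; \<open>w s t e a b\<close> collects every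
    \<open>e j\<close> whose exponent pair is \<open>(a, b)\<close>.\<close>
  have coeff: "2 * (l a * l' b + l' a * l b) - (2 * w id id d a b + w s t e a b + w t s e a b) = 0"
    if "a < 2 * r" "b < 2 * r" for a b
  proof (rule bilinearized_coeffs_zero[OF _ that])
    fix x y :: 'a
    let ?X = "\<lambda>j. x ^ (p ^ j)" and ?Y = "\<lambda>j. y ^ (p ^ j)"
    have 1: "2 * (L x * conj (L y) + conj (L x) * L y) =
      (\<Sum>a<2 * r. \<Sum>b<2 * r. 2 * (l a * l' b + l' a * l b) * (?X a * ?Y b))"
      unfolding L' unfolding l sum_product unfolding sum.distrib[symmetric]
      unfolding sum_distrib_left
      by (intro sum.cong) (simp_all add: algebra_simps)
    have d: "(\<Sum>j<2 * r. d j * (?X (id j) * ?Y (id j))) =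
      (\<Sum>a<2 * r. \<Sum>b<2 * r. w id id d a b * (?X a * ?Y b))"
      unfolding w_def by (rule sum_eq_double_sum) simp_all
    have "T (2 * (x * y + conj (x * y)) + (H x y - conj (H x y))) =
      2 * T (x * y + conj (x * y)) + T (H x y - conj (H x y))"
      by (simp only: mult_2 additive.add[OF T])
    also have "\<dots> = 2 * (\<Sum>j<2 * r. d j * (?X (id j) * ?Y (id j))) +
      ((\<Sum>j<2 * r. e j * (?X (s j) * ?Y (t j))) + (\<Sum>j<2 * r. e j * (?X (t j) * ?Y (s j))))"
      unfolding Td Te unfolding H by (simp add: power_mult_distrib distrib_left sum.distrib)
    also have "\<dots> = (\<Sum>a<2 * r. \<Sum>b<2 * r.
      (2 * w id id d a b + w s t e a b + w t s e a b) * (?X a * ?Y b))"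
      unfolding d sum_eq_double_sum[of s t e ?X ?Y, OF st]
        sum_eq_double_sum[of t s e ?X ?Y, OF st(2,1)] w_def[symmetric]
      unfolding sum_distrib_left distrib_right sum.distrib
      by (simp only: mult.assoc add.assoc)
    finally have 2: "T (2 * (x * y + conj (x * y)) + (H x y - conj (H x y))) = \<dots>" .
    show "(\<Sum>a<2 * r. \<Sum>b<2 * r.
      (2 * (l a * l' b + l' a * l b) - (2 * w id id d a b + w s t e a b + w t s e a b)) *
      (?X a * ?Y b)) = 0"
      using eq[of x y] unfolding 1 2 by (simp add: left_diff_distrib sum_subtractf)
  qed

  have st_neq: "s j \<noteq> t j" for j
  proof
    assume "s j = t j"
    then have "[i = k] (mod (2 * r))"
      unfolding s_def t_def cong_def[symmetric] by (simp add: cong_add_rcancel_nat)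
    then show False using \<open>i < k\<close> \<open>k < 2 * r\<close> by (simp add: cong_def)
  qed
  have st_opp: "t j \<noteq> opposite (s j)" for j
  proof
    assume "t j = opposite (s j)"
    then have "(k + j) mod (2 * r) = (i + j + r) mod (2 * r)"
      by (simp add: s_def t_def opposite_def mod_add_left_eq)
    then have "[k + j = i + r + j] (mod (2 * r))" by (simp add: cong_def ac_simps)
    then have "[k = i + r] (mod (2 * r))" by (simp add: cong_add_rcancel_nat)
    then show False using \<open>i < k\<close> \<open>k < 2 * r\<close> \<open>k \<noteq> i + r\<close>
      by (auto simp: cong_def mod_if split: if_splits)
  qed
  then have ts_opp: "s j \<noteq> opposite (t j)" for j
    using opposite_opposite st by metis

  have "l a = 0" if a: "a < 2 * r" for a
  proof (rule ccontr)
    assume la: "l a \<noteq> 0"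
    \<comment> \<open>At \<open>(a, a)\<close> only the trace term survives, so
      \<open>l a * l' a\<close> inherits from \<open>d a\<close> being fixed by
      \<open>conj\<close>.\<close>
    have "w id id d a a = d a" using a by (simp add: w_def sum.delta')
    moreover have "w s t e a a = 0" "w t s e a a = 0"
      unfolding w_def using st_neq st_neq[symmetric] by (auto intro!: sum.neutral)
    ultimately have "2 * (2 * (l a * l' a)) = 2 * d a" using coeff[OF a a] by (simp add: algebra_simps)
    then have "2 * (l a * l' a) = d a" using two_neq_0 by (metis mult_left_cancel)
    then have "conj (2 * (l a * l' a)) = 2 * (l a * l' a)" using conj_d[OF a] by simp
    then have fixed: "conj (l a * l' a) = l a * l' a"
      using two_neq_0 by (simp add: power_mult_distrib[of 2] conj_two)
    \<comment> \<open>At \<open>(a, opposite a)\<close> the right-hand side vanishes entirely, so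
      the norms of \<open>l a\<close> and \<open>l' a\<close> add up to zero.\<close>
    have "w id id d a (opposite a) = 0"
      unfolding w_def using opposite_neq[OF a] by (auto intro!: sum.neutral)
    moreover have "w s t e a (opposite a) = 0" "w t s e a (opposite a) = 0"
      unfolding w_def using st_opp ts_opp by (auto intro!: sum.neutral)
    ultimately have "l a * l' (opposite a) + l' a * l (opposite a) = 0"
      using coeff[OF a opposite_less, of a] two_neq_0 by (simp del: distrib_left_numeral)
    then have norms: "l a * conj (l a) = - (l' a * conj (l' a))"
      using a by (simp add: l'_def opposite_opposite conj_conj eq_neg_iff_add_eq_0)
    define u where "u = l a * conj (l a)"
    have u0: "u \<noteq> 0" using la by (simp add: u_def)
    have cu: "conj u = u" by (simp add: u_def power_mult_distrib conj_conj mult.commute)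
    \<comment> \<open>A fixed element has its square as norm; multiplicativity of the norm then
      gives \<open>- u\<^sup>2\<close>, and dividing by \<open>u\<close> yields a square root of -1
      fixed by \<open>conj\<close>.\<close>
    have "(l a * l' a)\<^sup>2 = (l a * l' a) * conj (l a * l' a)"
      using fixed by (simp add: power2_eq_square)
    also have "\<dots> = u * (l' a * conj (l' a))" by (simp add: u_def power_mult_distrib mult_ac)
    also have "\<dots> = - u\<^sup>2" using norms by (simp add: u_def power2_eq_square)
    finally have "(l a * l' a / u)\<^sup>2 = - 1" using u0 by (simp add: power_divide)
    moreover have "conj (l a * l' a / u) = l a * l' a / u"
      unfolding power_divide using fixed cu by simp
    ultimately show False using not_conj_square_neg_one[OF q] by blast
  qed
  then show ?thesis by (simp add: l)
qed

section \<open>Planarity of the monomial and nondegeneracy of the polar form of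
  \<open>f1\<close>\<close>

lemma exists_trace_zero: "\<exists>u. u \<noteq> 0 \<and> conj u = - u"
proof -
  obtain x where x: "conj x \<noteq> x"
  proof (rule ccontr)
    assume "\<not> thesis"
    then have all: "conj x = x" for x using that by blast
    \<comment> \<open>If \<open>conj\<close> were the identity, these would be nonzero coefficients
      of a linearized polynomial vanishing everywhere.\<close>
    define c :: "nat \<Rightarrow> 'a" where "c j = (if j = r then 1 else if j = 0 then - 1 else 0)" for j
    have "(\<Sum>j<2 * r. c j * x ^ (p ^ j)) = (\<Sum>j\<in>{0, r}. c j * x ^ (p ^ j))" for x
      using r_pos by (intro sum.mono_neutral_right) (auto simp: c_def)
    then have "(\<Sum>j<2 * r. c j * x ^ (p ^ j)) = 0" for x
      using r_pos all by (simp add: c_def)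
    from linearized_coeffs_zero[OF this, of r] show False using r_pos by (simp add: c_def)
  qed
  then show ?thesis
    by (intro exI[of _ "conj x - x"]) (simp add: frob_diff conj_conj)
qed

text \<open>A zero at \<open>u\<close> would make the difference function in direction 1 take the
  same value at \<open>u\<close> and at 0.\<close>

lemma planar_monomial_nondegenerate:
  assumes "planar (\<lambda>x::'a. x ^ (p ^ i + p ^ k))" and "u \<noteq> (0 :: 'a)"
  shows "u ^ (p ^ i) + u ^ (p ^ k) \<noteq> 0"
proof
  let ?h = "\<lambda>x::'a. x ^ (p ^ i + p ^ k)"
  assume z: "u ^ (p ^ i) + u ^ (p ^ k) = 0"
  have inj: "inj (\<lambda>x. ?h (x + 1) - ?h x)"
    using assms(1) by (simp add: planar_def bij_def)
  have "?h (u + 1) - ?h u = 1 + (u ^ (p ^ i) + u ^ (p ^ k))"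
    by (simp add: power_add frob_add algebra_simps)
  also have "\<dots> = ?h (0 + 1) - ?h 0" using z prime_p by (simp add: prime_gt_0_nat)
  finally have "u = 0" by (rule injD[OF inj])
  with assms(2) show False by simp
qed

text \<open>If \<open>a * x\<close> has trace zero, then with \<open>b = conj a\<close>, \<open>v = x / b\<close>, \<open>I = p ^ i\<close> and \<open>K = p ^ k\<close>
  the second component \<open>H - conj H\<close> of the polar form factors as
  \<open>(a ^ I * b ^ K + b ^ I * a ^ K) * (v ^ I + v ^ K)\<close>.\<close>

lemma polar_form_nondegenerate:
  assumes nz: "\<And>u::'a. u \<noteq> 0 \<Longrightarrow> u ^ (p ^ i) + u ^ (p ^ k) \<noteq> 0"
    and H_def: "H = a ^ (p ^ i) * x ^ (p ^ k) + a ^ (p ^ k) * x ^ (p ^ i)"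
    and D: "2 * (a * x + conj (a * x)) + (H - conj H) = 0"
    and a: "a \<noteq> 0"
  shows "x = 0"
proof (rule ccontr)
  assume x: "x \<noteq> 0"
  \<comment> \<open>Conjugation fixes the trace part of \<open>D\<close> and negates
    \<open>H - conj H\<close>, so the two parts vanish separately.\<close>
  have "conj (2 * (a * x + conj (a * x)) + (H - conj H)) = 0"
    using D prime_p by (simp add: prime_gt_0_nat)
  then have D': "2 * (a * x + conj (a * x)) - (H - conj H) = 0"
    by (simp only: frob_add frob_diff conj_conj power_mult_distrib[of 2] conj_two)
      (simp add: algebra_simps)
  have "2 * (2 * (a * x + conj (a * x))) =
    (2 * (a * x + conj (a * x)) + (H - conj H)) + (2 * (a * x + conj (a * x)) - (H - conj H))"
    by simp
  then have "2 * (2 * (a * x + conj (a * x))) = 0" unfolding D D' by simp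
  then have tr: "conj (a * x) = - (a * x)"
    using two_neq_0 by (metis add.commute eq_neg_iff_add_eq_0 mult_eq_0_iff)
  then have HH: "H = conj H" using D by simp
  define b where "b = conj a"
  define v where "v = x / b"
  have b: "b \<noteq> 0" using a by (simp add: b_def)
  have v: "v \<noteq> 0" using b x by (simp add: v_def)
  have xv: "x = b * v" and cxv: "conj x = - (a * v)"
    using a b tr by (simp_all add: v_def b_def power_mult_distrib field_simps)
  let ?I = "p ^ i" and ?K = "p ^ k"
  define W where "W = a ^ ?I * b ^ ?K + b ^ ?I * a ^ ?K"
  have "conj H = b ^ ?I * conj x ^ ?K + b ^ ?K * conj x ^ ?I"
    by (simp add: H_def frob_add power_mult_distrib b_def mult.commute flip: power_mult)
  then have cH: "conj H = - (b ^ ?I * (a * v) ^ ?K + b ^ ?K * (a * v) ^ ?I)"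
    by (simp add: cxv frob_minus)
  have "W * (v ^ ?I + v ^ ?K) = H - conj H"
    unfolding cH unfolding H_def xv W_def by (simp add: power_mult_distrib algebra_simps)
  then have "W = 0"
    using HH nz[OF v] by auto
  \<comment> \<open>Dividing by powers of \<open>b\<close> turns \<open>W\<close> into the same
    binomial at \<open>a / b\<close>, so \<open>nz\<close> excludes \<open>W = 0\<close> as
    well.\<close>
  have "W = (b ^ ?I * b ^ ?K) * ((a / b) ^ ?I + (a / b) ^ ?K)"
    unfolding W_def using b by (simp add: power_divide field_simps)
  then show False using \<open>W = 0\<close> nz[of "a / b"] a b by simp
qed

section \<open>Traces of generalized Budaghyan-Helleseth functions and the affine form of
  CCZ-equivalence\<close>

lemma trace_generalized_BH:
  assumes "generalized_BH p r B"
  shows "B z + conj (B z) = 2 * (z * conj z)"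
proof -
  from assms obtain s \<omega> \<beta> where \<omega>: "\<omega> + conj \<omega> = 0"
    and B: "B = (\<lambda>x. x ^ (p ^ r + 1) + \<omega> * \<beta> * x ^ (p ^ s + 1)
                 + \<omega> * conj \<beta> * x ^ ((p ^ s + 1) * p ^ r))"
    unfolding generalized_BH_def by blast
  define v where "v = \<beta> * z ^ (p ^ s + 1)"
  \<comment> \<open>The last two terms are \<omega> times the trace of \<open>v\<close>; as
    \<open>conj\<close> negates \<omega>, their own trace is zero and only the norm of
    \<open>z\<close> contributes.\<close>
  have Bz: "B z = z * conj z + \<omega> * (v + conj v)"
    unfolding B v_def power_mult_distrib
    by (simp only: power_mult[of z "p ^ s + 1"]) (simp add: algebra_simps)
  have "conj \<omega> = - \<omega>" using \<omega> by (simp add: eq_neg_iff_add_eq_0 add.commute)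
  then have "conj (B z) = z * conj z - \<omega> * (v + conj v)"
    by (simp add: Bz frob_add power_mult_distrib conj_conj algebra_simps)
  then show ?thesis by (simp add: Bz)
qed

end

text \<open>Points of the image graph are determined by their first coordinate. If
  \<open>L a + L' y = 0\<close> with \<open>a \<noteq> 0\<close>, writing \<open>y\<close> as a
  difference of \<open>f\<close> in direction \<open>a\<close> gives two points with equal first
  coordinate. Hence \<open>L\<close> is injective, so surjective, and \<open>L'\<close> must
  vanish.\<close>

lemma CCZ_equivalent_planar_affine:
  assumes "CCZ_equivalent f B"
    and surj: "\<And>a. a \<noteq> 0 \<Longrightarrow> surj (\<lambda>x. f (x + a) - f x)"
  obtains L M N :: "'a::{finite,field} \<Rightarrow> 'a" and t t'
  where "additive L" "additive M" "additive N" "inj L"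
    and "\<And>x. B (L x + t) = M (f x) + N x + t'"
proof -
  from assms(1) obtain A \<Lambda> \<tau> where "bij A" and lin: "prime_field_linear \<Lambda>"
    and A: "\<And>z. A z = \<Lambda> z + \<tau>" and img: "A ` fun_graph f = fun_graph B"
    unfolding CCZ_equivalent_def affine_permutation_def by blast
  have add: "\<Lambda> (u + v) = \<Lambda> u + \<Lambda> v" for u v
    using lin unfolding prime_field_linear_def by blast
  define L where "L x = fst (\<Lambda> (x, 0))" for x
  define L' where "L' y = fst (\<Lambda> (0, y))" for y
  define N where "N x = snd (\<Lambda> (x, 0))" for x
  define M where "M y = snd (\<Lambda> (0, y))" for y
  have additive: "additive L" "additive L'" "additive N" "additive M"
    unfolding L_def L'_def N_def M_def
    using add[of "(_, 0)" "(_, 0)"] add[of "(0, _)" "(0, _)"]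
    by (unfold_locales; simp)+
  have split: "\<Lambda> (x, y) = (L x + L' y, N x + M y)" for x y
    using add[of "(x, 0)" "(0, y)"] by (simp add: L_def L'_def N_def M_def prod_eq_iff)
  have graph: "B (fst (A (x, f x))) = snd (A (x, f x))" for x
  proof -
    have "A (x, f x) \<in> A ` fun_graph f" by (auto simp: fun_graph_def)
    then have "A (x, f x) \<in> fun_graph B" by (simp only: img)
    then show ?thesis by (auto simp: fun_graph_def)
  qed
  have fst_inj: "x = x'" if "fst (A (x, f x)) = fst (A (x', f x'))" for x x'
  proof -
    have "A (x, f x) = A (x', f x')" using that graph by (metis prod_eq_iff)
    then show ?thesis using \<open>bij A\<close> by (simp add: bij_def inj_eq)
  qed
  have neq: "L a + L' y \<noteq> 0" if "a \<noteq> 0" for a y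
  proof
    assume z: "L a + L' y = 0"
    from surj[OF that] obtain x where "y = f (x + a) - f x" by (rule surjE)
    with z have "fst (A (x + a, f (x + a))) = fst (A (x, f x))"
      by (simp add: A split additive.add[OF additive(1)] additive.diff[OF additive(2)]
          algebra_simps)
    from fst_inj[OF this] that show False by simp
  qed
  have "inj L"
  proof (rule injI)
    fix x x' assume "L x = L x'"
    then show "x = x'"
      using neq[of "x - x'" 0]
      by (auto simp: additive.diff[OF additive(1)] additive.zero[OF additive(2)])
  qed
  have "L' y = 0" for y
  proof (rule ccontr)
    assume "L' y \<noteq> 0"
    have "surj L" using finite_UNIV_inj_surj[OF finite \<open>inj L\<close>] .
    then obtain a where a: "- L' y = L a" by (rule surjE)
    with \<open>L' y \<noteq> 0\<close> have "a \<noteq> 0"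
      using additive.zero[OF additive(1)] by auto
    moreover from a have "L a + L' y = 0" by (metis left_minus)
    ultimately show False using neq by blast
  qed
  then have "B (L x + fst \<tau>) = M (f x) + N x + snd \<tau>" for x
    using graph[of x] by (simp add: A split add.commute)
  then show ?thesis by (rule that[OF additive(1,4,3) \<open>inj L\<close>])
qed

section \<open>Polarizing the equivalence between \<open>f1\<close> and \<open>B\<close>\<close>

theorem theorem7:
  fixes p r i k :: nat
    and h f1 :: "'a::{finite,field} \<Rightarrow> 'a"
  assumes "prime p" and "[p = 3] (mod 4)"
    and "odd r"
    and "CARD('a) = p ^ (2 * r)"
    and "i < k" and "k < 2 * r"
    and "h = (\<lambda>x. x ^ (p ^ i + p ^ k))"
    and "planar h"
    and "f1 = (\<lambda>x. x\<^sup>2 + x ^ (2 * p ^ r) + h x - h x ^ (p ^ r))"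
  shows "\<forall>B :: 'a \<Rightarrow> 'a. generalized_BH p r B \<longrightarrow> \<not> CCZ_equivalent f1 B"
proof (intro allI impI notI)
  fix B :: "'a \<Rightarrow> 'a" assume B: "generalized_BH p r B" and ccz: "CCZ_equivalent f1 B"
  have "p mod 4 = 3" using assms(2) by (simp add: cong_def)
  then have "odd p" by presburger
  interpret quadratic_frobenius_field p r "TYPE('a)"
    by unfold_locales (use assms \<open>odd p\<close> in auto)
  \<comment> \<open>Because \<open>r\<close> is odd and 9 is 1 modulo 4, \<open>p ^ r\<close> stays
    3 modulo 4.\<close>
  obtain m where m: "r = 2 * m + 1" using \<open>odd r\<close> by (auto elim: oddE)
  have "[(p ^ 2) ^ m * p = (3 ^ 2) ^ m * 3] (mod 4)"
    by (intro cong_mult cong_pow assms(2))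
  moreover have "[(3 ^ 2) ^ m * 3 = 1 ^ m * 3] (mod (4::nat))"
    by (intro cong_mult cong_pow) (simp_all add: cong_def)
  ultimately have "[(p ^ 2) ^ m * p = 3] (mod 4)"
    by (metis cong_trans mult_1 power_one)
  then have q: "[p ^ r = 3] (mod 4)"
    by (simp only: m power_add power_mult power_one_right)
  have nz: "u ^ (p ^ i) + u ^ (p ^ k) \<noteq> 0" if "u \<noteq> 0" for u :: 'a
    using planar_monomial_nondegenerate[of i k u] assms that by simp
  have "k \<noteq> i + r"
  proof
    assume k: "k = i + r"
    \<comment> \<open>For \<open>k = i + r\<close>, a nonzero element of trace zero would make the
      two powers in \<open>nz\<close> cancel.\<close>
    obtain u where u: "u \<noteq> 0" "conj u = - u" using exists_trace_zero by blast
    have "u ^ (p ^ k) = conj u ^ (p ^ i)" by (simp add: k power_add mult.commute flip: power_mult)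
    also have "\<dots> = - (u ^ (p ^ i))" by (simp add: u frob_minus)
    finally show False using nz[OF u(1)] by simp
  qed

  define H where "H x y = x ^ (p ^ i) * y ^ (p ^ k) + x ^ (p ^ k) * y ^ (p ^ i)" for x y :: 'a
  define D where "D x y = 2 * (x * y + conj (x * y)) + (H x y - conj (H x y))" for x y
  have h: "h (x + y) = h x + h y + H x y" for x y
    unfolding assms(7) H_def by (simp add: power_add frob_add algebra_simps)
  have f1: "f1 x = x\<^sup>2 + conj (x\<^sup>2) + (h x - conj (h x))" for x
    unfolding assms(9) by (simp flip: power_mult)
  have polar: "f1 (x + y) = f1 x + f1 y + D x y" for x y
  proof -
    have "conj ((x + y)\<^sup>2) = conj (x\<^sup>2) + conj (y\<^sup>2) + 2 * conj (x * y)"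
      by (simp only: power2_sum frob_add mult.assoc power_mult_distrib[of 2] conj_two)
    then show ?thesis
      unfolding f1 h D_def by (simp add: power2_sum frob_add algebra_simps)
  qed
  \<comment> \<open>Differences of \<open>f1\<close> are affine with linear part \<open>D\<close>,
    so nondegeneracy makes them injective, hence surjective on a finite field.\<close>
  have "surj (\<lambda>x. f1 (x + a) - f1 x)" if a: "a \<noteq> 0" for a
  proof (rule finite_UNIV_inj_surj[OF finite], rule injI)
    fix x y assume "f1 (x + a) - f1 x = f1 (y + a) - f1 y"
    then have "D x a = D y a" by (simp add: polar)
    moreover have "D x a = D (x - y) a + D y a"
      by (simp add: D_def H_def frob_add frob_diff power_mult_distrib algebra_simps)
    ultimately have "D a (x - y) = 0"
      by (simp add: D_def H_def mult.commute add.commute)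
    then show "x = y"
      using polar_form_nondegenerate[OF nz _ _ a, of "H a (x - y)" "x - y"]
      by (simp add: D_def H_def)
  qed
  from CCZ_equivalent_planar_affine[OF ccz this] obtain L M N t t'
    where add: "additive L" "additive M" "additive N" and "inj L"
      and BL: "\<And>x. B (L x + t) = M (f1 x) + N x + t'" by blast
  define T where "T z = M z + conj (M z)" for z
  define g where "g x = 2 * ((L x + t) * conj (L x + t))" for x
  have T: "additive T"
    by standard (simp add: T_def additive.add[OF add(2)] frob_add)
  have g: "g x = T (f1 x) + (N x + conj (N x)) + (t' + conj t')" for x
    unfolding g_def trace_generalized_BH[OF B, symmetric] BL
    by (simp add: T_def frob_add algebra_simps)
  have "2 * (L x * conj (L y) + conj (L x) * L y) = T (D x y)" for x y
  proof -
    \<comment> \<open>This second difference removes the shift \<open>t\<close>, the additive part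
      \<open>N\<close> and the constant \<open>t'\<close>, leaving only polar forms.\<close>
    have "2 * (L x * conj (L y) + conj (L x) * L y) = g (x + y) - g x - g y + g 0"
      by (simp add: g_def additive.add[OF add(1)] additive.zero[OF add(1)] frob_add algebra_simps)
    also have "\<dots> = T (D x y) + T (f1 0) + conj (N 0)"
      by (simp add: g polar additive.add[OF T] additive.add[OF add(3)] additive.zero[OF add(3)]
          frob_add algebra_simps)
    also have "f1 0 = 0" using prime_gt_0_nat[OF prime_p] by (simp add: assms(7,9) power_0_left)
    finally show ?thesis
      using prime_gt_0_nat[OF prime_p]
      by (simp add: additive.zero[OF T] additive.zero[OF add(3)] power_0_left)
  qed
  moreover have "conj (T z) = T z" for z
    by (simp add: T_def frob_add conj_conj add.commute)
  ultimately have "L 1 = 0"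
    using norm_trace_component_imp_zero[OF q \<open>i < k\<close> \<open>k < 2 * r\<close> \<open>k \<noteq> i + r\<close> add(1) T, of H]
    unfolding D_def H_def by blast
  with \<open>inj L\<close> show False
    by (metis additive.zero[OF add(1)] injD zero_neq_one)
qed

end
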